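(* Let $\delta>0$ be fixed and let $n\ge0$ be an integer. For each integer $m\ge2$ one has the asymptotic expansion $$\zeta_E^{(m)}(-n,q)\sim-\sum_{j=1}^m\binom mj\zeta_E^{(m-j)}(-n,q)\log^jq-\frac12\Sigma_m(-n,q)$$ as $|q|\to\infty$ in the sector $|\arg q|\le\pi-\delta$, where $$\Sigma_m(-n,q)=\sum_{k=1}^\infty q^{n-2k-1}c_k^m(-n)$$ and $$c_k^m(-n)=E_{2k+1}(0)\sum_{j_1=0}^{2k}\frac1{2k-j_1+1}\sum_{j_2=0}^{j_1-1}\frac1{j_1-j_2}\cdots\sum_{j_m=0}^{\mu_m}\binom{n}{j_m}\frac{(-1)^{j_m}}{j_{m-1}-j_m},$$ in which $\mu_m=\min(n,j_{m-1}-1)$.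
   Context: For $|\arg q|<\pi$, $\zeta_E(s,q)$ denotes the alternating Hurwitz zeta function, defined for $\mathrm{Re}(s)>0$ by $\zeta_E(s,q)=\sum_{n=0}^\infty \frac{(-1)^n}{(n+q)^s}$ (principal branches) and extended to an entire function of $s\in\mathbb C$ by analytic continuation; $\zeta_E^{(m)}(-n,q)=\frac{\partial^m}{\partial s^m}\zeta_E(s,q)\big|_{s=-n}$ and $\zeta_E^{(0)}=\zeta_E$. $E_n(x)$ are the Euler polynomials, $\frac{2e^{xt}}{e^t+1}=\sum_{n\ge0}E_n(x)\frac{t^n}{n!}$ for $|t|<\pi$. $\log^jq=(\log q)^j$ with the principal logarithm. Empty sums are zero. In the nested sum, the inner indices $j_i$ with $2\le i\le m-1$ run from $0$ to $j_{i-1}-1$ with weight $\frac1{j_{i-1}-j_i}$. $\Sigma_m(-n,q)$ is a formal (asymptotic) series. The symbol $\sim$ means asymptotic expansion in the Poincaré sense: for each integer $K\ge0$, the difference between the left side and the right side with the series $\Sigma_m$ truncated after $k=K$ is $O(|q|^{n-2K-3})$ as $|q|\to\infty$ in the sector, the implied constant depending only on $n,m,\delta,K$. *)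

theory Defs
  imports "HOL-Complex_Analysis.Complex_Analysis" "HOL-Library.Landau_Symbols"
begin

definition euler_poly :: "nat \<Rightarrow> complex \<Rightarrow> complex" where
  "euler_poly n x = fact n * fps_nth (2 * fps_exp x / (fps_exp 1 + 1)) n"

lemma euler_poly_generating_function:
  fixes x t :: complex
  assumes t: "norm t < pi"
  shows "(\<lambda>n. euler_poly n x * t ^ n / fact n) sums (2 * exp (x * t) / (exp t + 1))"
proof -
  let ?f = "\<lambda>t. 2 * exp (x * t) / (exp t + 1)"
  let ?F = "2 * fps_exp x / (fps_exp 1 + 1) :: complex fps"
  have nz: "exp t + 1 \<noteq> 0" if "t \<in> ball 0 pi" for t :: complex
  proof
    assume "exp t + 1 = 0"
    hence "exp t = exp (\<i> * of_real pi)"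
      by (simp add: add_eq_0_iff2)
    then obtain n :: int where n: "t = \<i> * of_real pi + (of_int (2 * n) * pi) * \<i>"
      unfolding exp_eq by blast
    hence "Im t = real_of_int (2 * n + 1) * pi"
      by (simp add: algebra_simps)
    hence "\<bar>Im t\<bar> = \<bar>real_of_int (2 * n + 1)\<bar> * pi"
      by (simp only: abs_mult abs_of_pos [OF pi_gt_zero])
    moreover have "\<bar>2 * n + 1\<bar> \<ge> 1" by presburger
    hence "\<bar>real_of_int (2 * n + 1)\<bar> \<ge> 1" by linarith
    ultimately have "\<bar>Im t\<bar> \<ge> pi"
      using pi_gt_zero by simp
    moreover have "norm t < pi" using that by simp
    ultimately show False using abs_Im_le_cmod [of t] by linarith
  qed
  have exp1: "?f has_fps_expansion ?F"
    by (rule has_fps_expansion_divide') (auto intro!: fps_expansion_intros)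
  have holo: "?f holomorphic_on ball 0 pi"
    by (intro holomorphic_intros nz)
  have coeff: "fps_nth ?F n = (deriv ^^ n) ?f 0 / fact n" for n
    using fps_nth_fps_expansion [OF exp1] .
  have "(\<lambda>n. (deriv ^^ n) ?f 0 / fact n * (t - 0) ^ n) sums ?f t"
    by (rule holomorphic_power_series [OF holo]) (use t in simp)
  thus ?thesis
    by (simp add: euler_poly_def coeff)
qed

text \<open>
  The definite description is meant for \<open>q\<close> off the closed negative real axis
  (including the origin): there the series converges for \<open>Re s > 0\<close>, it has an entire
  continuation, and the continuation is unique by the identity theorem.  The series converges only
  conditionally when \<open>Re s \<le> 1\<close>, so \<open>sums\<close> is the right notion of summation.
\<close>
definition alt_hurwitz_zeta :: "complex \<Rightarrow> complex \<Rightarrow> complex" where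
  "alt_hurwitz_zeta s q =
     (THE f. f holomorphic_on UNIV \<and>
        (\<forall>z. Re z > 0 \<longrightarrow> (\<lambda>n. (-1) ^ n / (of_nat n + q) powr z) sums f z)) s"

definition alt_hurwitz_zeta_deriv :: "nat \<Rightarrow> complex \<Rightarrow> complex \<Rightarrow> complex" where
  "alt_hurwitz_zeta_deriv m s q = (deriv ^^ m) (\<lambda>z. alt_hurwitz_zeta z q) s"

text \<open>
  \<open>nested_sum n r j\<close> consists of the last \<open>r + 1\<close> sums of the nested sum, that is those over
  \<open>j\<^bsub>m-r\<^esub>, \<dots>, j\<^bsub>m\<^esub>\<close>, with \<open>j = j\<^bsub>m-r-1\<^esub>\<close>.  The innermost index set is
  \<open>{0..min n (j - 1)}\<close> with integer subtraction, hence empty for \<open>j = 0\<close>.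
\<close>
primrec nested_sum :: "nat \<Rightarrow> nat \<Rightarrow> nat \<Rightarrow> complex" where
  "nested_sum n 0 j =
     (\<Sum>i\<in>{i. i \<le> n \<and> i < j}. of_nat (n choose i) * (-1) ^ i / of_nat (j - i))"
| "nested_sum n (Suc r) j = (\<Sum>i<j. 1 / of_nat (j - i) * nested_sum n r i)"

text \<open>This is \<open>c\<^sub>k\<^sup>m(-n)\<close>; it is only meaningful for \<open>m \<ge> 2\<close>.\<close>
definition asymp_coeff :: "nat \<Rightarrow> nat \<Rightarrow> nat \<Rightarrow> complex" where
  "asymp_coeff m n k =
     euler_poly (2 * k + 1) 0 *
       (\<Sum>i\<le>2 * k. 1 / of_nat (2 * k - i + 1) * nested_sum n (m - 2) i)"

text \<open>The formal series \<open>\<Sigma>\<^sub>m(-n, q)\<close>, truncated after \<open>k = K\<close>.\<close>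
definition Sigma_trunc :: "nat \<Rightarrow> nat \<Rightarrow> nat \<Rightarrow> complex \<Rightarrow> complex" where
  "Sigma_trunc m n K q =
     (\<Sum>k=1..K. q powi (int n - 2 * int k - 1) * asymp_coeff m n k)"

text \<open>
  The origin is excluded because \<open>Arg 0 = 0\<close> by convention.
\<close>
definition sector :: "real \<Rightarrow> complex set" where
  "sector \<delta> = {q. q \<noteq> 0 \<and> \<bar>Arg q\<bar> \<le> pi - \<delta>}"

end

theory Submission
  imports Defs
begin

text \<open>
  Let \<open>h(x)\<close> be the truncated Boole sum \<open>1/2 \<Sum>\<^sub>j\<^sub><\<^sub>N E\<^sub>j(0)/j! f\<^sup>(\<^sup>j\<^sup>)(x)\<close> of \<open>f(x) = x powr (-s)\<close>.  The
  recurrence for \<open>E\<^sub>j(0)\<close> makes \<open>r(x) = h(x) + h(x + 1) - f(x)\<close> equal to \<open>x powr (-s)\<close> times a function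
  of \<open>1/x\<close> vanishing to order \<open>N\<close> at \<open>0\<close>, uniformly for bounded \<open>s\<close>.  Telescoping the alternating
  sum gives \<open>\<zeta>\<^sub>E(s,q) = h(q) - \<Sum>\<^sub>k (-1)\<^sup>k r(q + k)\<close>, where the series converges locally uniformly for
  \<open>Re s > 2 - N\<close>.  This yields the entire continuation and, in a sector, where
  \<open>|q + k| \<ge> c (|q| + k)\<close>, the asymptotic expansion of \<open>q\<^sup>s \<zeta>\<^sub>E(s,q)\<close> uniformly on the disc
  \<open>|s + n| \<le> 1\<close>.  By Cauchy's inequality it may be differentiated \<open>m\<close> times at \<open>s = -n\<close>.  Leibniz'
  rule on the left-hand side produces the powers of \<open>log q\<close>, and on the right-hand side the \<open>m\<close>-th
  derivative of \<open>(s)\<^sub>j / j!\<close> is the nested sum, since the first one is \<open>\<Sum>\<^sub>i\<^sub><\<^sub>j (s)\<^sub>i / (i! (j - i))\<close>.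
\<close>

section \<open>Values of the Euler polynomials at zero\<close>

definition euler_coeff :: "nat \<Rightarrow> complex" where
  "euler_coeff j = fps_nth (2 / (fps_exp 1 + 1)) j"

lemma euler_poly_0: "euler_poly j 0 = fact j * euler_coeff j"
  by (simp add: euler_poly_def euler_coeff_def)

lemma euler_fps_mult:
  "(fps_exp 1 + 1) * (2 / (fps_exp 1 + 1)) = (2 :: complex fps)"
proof -
  have "fps_nth (fps_exp 1 + 1 :: complex fps) 0 \<noteq> 0"
    by simp
  thus ?thesis
    by (simp add: fps_divide_unit inverse_mult_eq_1' mult.left_commute)
qed

text \<open>Compare coefficients of \<open>t^M\<close> in
  \<open>(2 / (e^t + 1)) * (e^t + 1) = 2\<close>: the sum comes from \<open>e^t\<close>, the extra
  \<open>euler_coeff M\<close> from the summand \<open>1\<close>.\<close>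

lemma euler_coeff_recurrence:
  "(\<Sum>j\<le>M. euler_coeff j / fact (M - j)) + euler_coeff M = (if M = 0 then 2 else 0)"
proof -
  have "fps_nth ((2 / (fps_exp 1 + 1)) * (fps_exp 1 + 1) :: complex fps) M = fps_nth 2 M"
    by (subst mult.commute) (simp only: euler_fps_mult)
  thus ?thesis
    by (simp add: distrib_left fps_mult_nth euler_coeff_def atMost_atLeast0 numeral_fps_const)
qed

text \<open>\<open>2 / (e\<^sup>t + 1) - 1\<close> is odd in \<open>t\<close>.\<close>
lemma euler_coeff_even:
  assumes "even j" "j > 0"
  shows "euler_coeff j = 0"
proof -
  let ?F = "2 / (fps_exp 1 + 1) :: complex fps"
  let ?R = "\<lambda>f. fps_compose f (- fps_X) :: complex fps"
  have R: "?R (fps_exp 1) = fps_exp (-1)"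
    using fps_compose_linear[of "fps_exp (1::complex)" "-1"]
    by (simp add: fps_eq_iff fps_const_neg[symmetric] del: fps_const_neg)
  have E: "fps_exp (-1) * fps_exp 1 = (1 :: complex fps)"
    by (simp flip: fps_exp_add_mult)
  have "?R ((fps_exp 1 + 1) * ?F) = ?R 2"
    by (simp only: euler_fps_mult)
  hence "(fps_exp (-1) + 1) * ?R ?F = 2"
    by (subst (asm) fps_compose_mult_distrib)
       (simp_all add: fps_compose_add_distrib R numeral_fps_const)
  \<comment> \<open>Multiplying by \<open>e^t\<close> turns \<open>e^(-t) + 1\<close> back into
    \<open>e^t + 1\<close>, so \<open>?F\<close> and its reflection can be added over a common
    denominator.\<close>
  hence "fps_exp 1 * ((fps_exp (-1) + 1) * ?R ?F) = fps_exp 1 * 2"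
    by simp
  moreover have "fps_exp 1 * ((fps_exp (-1) + 1) * ?R ?F) = (fps_exp 1 + 1) * ?R ?F"
    using E by (simp add: algebra_simps flip: mult.assoc)
  ultimately have "(fps_exp 1 + 1) * (?R ?F + ?F) = (fps_exp 1 + 1) * 2"
    using euler_fps_mult by (simp add: algebra_simps)
  moreover have "fps_exp 1 + 1 \<noteq> (0 :: complex fps)"
    by (metis add_eq_0_iff one_neq_zero euler_fps_mult mult_zero_left zero_neq_numeral)
  ultimately have "?R ?F + ?F = 2"
    by (metis mult_cancel_left)
  \<comment> \<open>For \<open>j > 0\<close> this reads
    \<open>((-1)^j + 1) * euler_coeff j = 0\<close>.\<close>
  hence "fps_nth (?R ?F + ?F) j = fps_nth 2 j"
    by simp
  moreover have "?R ?F = Abs_fps (\<lambda>n. (-1) ^ n * fps_nth ?F n)"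
    using fps_compose_linear[of ?F "-1"]
    by (simp add: fps_const_neg[symmetric] del: fps_const_neg)
  ultimately show ?thesis
    using assms by (simp add: numeral_fps_const euler_coeff_def)
qed

section \<open>Truncated Boole summation\<close>

text \<open>\<open>x powr (-s) * boole_main N s (1 / x)\<close> is the Boole summation formula for the function
  \<open>x powr (-s)\<close>, truncated before the term of index \<open>N\<close>.\<close>
definition boole_main :: "nat \<Rightarrow> complex \<Rightarrow> complex \<Rightarrow> complex" where
  "boole_main N s u = (\<Sum>j<N. euler_coeff j * (-1) ^ j * pochhammer s j * u ^ j) / 2"

definition boole_rem :: "nat \<Rightarrow> complex \<Rightarrow> complex \<Rightarrow> complex" where
  "boole_rem N s x = x powr (-s) * boole_main N s (1 / x) +
     (x + 1) powr (-s) * boole_main N s (1 / (x + 1)) - x powr (-s)"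

text \<open>The remainder with the factor \<open>x powr (-s)\<close> removed, as a function of \<open>u = 1 / x\<close>; here
  \<open>1 / (x + 1) = u / (1 + u)\<close>, and the powers of \<open>1 + u\<close> are merged.\<close>
definition boole_defect :: "nat \<Rightarrow> complex \<Rightarrow> complex \<Rightarrow> complex" where
  "boole_defect N s u =
     (\<Sum>j<N. euler_coeff j * (-1) ^ j * pochhammer s j * (u ^ j * (1 + (1 + u) powr (- s - of_nat j)))) / 2 - 1"

text \<open>The imaginary parts of \<open>x\<close> and \<open>1 + 1 / x\<close> have opposite
  signs, so the sum of the arguments stays in the principal range; for real \<open>x > 0\<close> the
  argument of \<open>x\<close> is zero.\<close>

lemma Ln_add_1:
  assumes "x \<notin> \<real>\<^sub>\<le>\<^sub>0"
  shows "Ln (x + 1) = Ln x + Ln (1 + 1 / x)"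
proof -
  have x0: "x \<noteq> 0" using assms by auto
  have x1: "1 + 1 / x \<noteq> 0"
  proof
    assume "1 + 1 / x = 0"
    hence "x = -1" using x0 by (simp add: field_simps eq_neg_iff_add_eq_0)
    thus False using assms by simp
  qed
  have "Im (1 + 1 / x) = - Im x / (cmod x)\<^sup>2"
    by (simp add: Im_divide cmod_power2)
  hence im: "Im (1 + 1 / x) < 0 \<longleftrightarrow> Im x > 0" "Im (1 + 1 / x) > 0 \<longleftrightarrow> Im x < 0"
    using x0 by (simp_all add: divide_less_0_iff zero_less_divide_iff)
  have "-pi < Im (Ln x) + Im (Ln (1 + 1 / x)) \<and> Im (Ln x) + Im (Ln (1 + 1 / x)) \<le> pi"
  proof (cases "Im x" "0 :: real" rule: linorder_cases)
    case greater
    hence "Im (1 + 1 / x) < 0" by (simp only: im)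
    thus ?thesis using greater x0 x1 Im_Ln_pos_lt_imp[of x]
      using Im_Ln_pos_le[of "1 + 1/x"] Im_Ln_le_pi[of "1 + 1 / x"] mpi_less_Im_Ln[of "1 + 1 / x"]
      by linarith
  next
    case less
    hence "Im (1 + 1 / x) > 0" by (simp only: im)
    thus ?thesis using less x0 x1 Im_Ln_pos_lt_imp[of "1 + 1 / x"]
      using Im_Ln_pos_le[of x] Im_Ln_le_pi[of x] mpi_less_Im_Ln[of x]
      by linarith
  next
    case equal
    hence "Re x > 0" using assms complex_nonpos_Reals_iff by force
    hence "Im (Ln x) = 0" using equal x0 by (simp add: Im_Ln_eq_0)
    thus ?thesis using x1 Im_Ln_le_pi mpi_less_Im_Ln by simp
  qed
  hence "Ln (x * (1 + 1 / x)) = Ln x + Ln (1 + 1 / x)"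
    using x0 x1 by (intro Ln_times_simple) auto
  thus ?thesis using x0 by (simp add: distrib_left)
qed

text \<open>By \<open>Ln_add_1\<close>,
  \<open>(x + 1) powr (-s) = x powr (-s) * (1 + 1 / x) powr (-s)\<close> on principal branches, so
  \<open>x powr (-s)\<close> factors out of all three terms.\<close>

lemma boole_rem_eq:
  assumes "x \<notin> \<real>\<^sub>\<le>\<^sub>0"
  shows "boole_rem N s x = x powr (-s) * boole_defect N s (1 / x)"
proof -
  have x0: "x \<noteq> 0" using assms by auto
  have x1: "x + 1 \<noteq> 0"
    using assms by (metis add_eq_0_iff2 nonpos_Reals_of_real_iff of_real_1 of_real_minus neg_le_0_iff_le zero_le_one)
  have y: "1 + 1 / x = (x + 1) / x" using x0 by (simp add: field_simps)
  have y0: "1 + 1 / x \<noteq> 0" using x0 x1 by (simp add: y)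
  have p: "(x + 1) powr (-s) = x powr (-s) * (1 + 1 / x) powr (-s)"
    using x0 x1 y0 Ln_add_1[OF assms] by (simp add: powr_def exp_add[symmetric] algebra_simps)
  have "(x + 1) powr (-s) * (1 / (x + 1)) ^ j = x powr (-s) * ((1 / x) ^ j * (1 + 1 / x) powr (- s - of_nat j))" for j
  proof -
    have "(1 + 1 / x) powr (- s - of_nat j) = (1 + 1 / x) powr (- s) / (1 + 1 / x) ^ j"
      using y0 by (simp add: powr_diff powr_nat')
    thus ?thesis using x0 x1 unfolding p y by (simp add: field_simps)
  qed
  hence *: "(x + 1) powr (-s) * (c * (1 / (x + 1)) ^ j) = x powr (-s) * (c * ((1 / x) ^ j * (1 + 1 / x) powr (- s - of_nat j)))" for c j
    by (metis mult.left_commute)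
  show ?thesis
    unfolding boole_rem_def boole_main_def boole_defect_def times_divide_eq_right
      sum_distrib_left * right_diff_distrib distrib_left mult_1_right sum.distrib
    by (simp add: add_divide_distrib)
qed

lemma boole_defect_holomorphic:
  "boole_defect N s holomorphic_on ball 0 1"
proof -
  have "1 + u \<notin> \<real>\<^sub>\<le>\<^sub>0" if "u \<in> ball 0 1" for u :: complex
    using that abs_Re_le_cmod[of u] by (auto simp: complex_nonpos_Reals_iff)
  thus ?thesis
    unfolding boole_defect_def by (auto intro!: holomorphic_intros)
qed

lemma boole_defect_continuous:
  "continuous_on (UNIV \<times> cball 0 (1/2)) (\<lambda>(s, u). boole_defect N s u)"
proof -
  have *: "0 < 1 + Re u" if "cmod u * 2 \<le> 1" for u
    using that abs_Re_le_cmod[of u] by auto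
  show ?thesis
    unfolding boole_defect_def case_prod_unfold pochhammer_prod
    by (intro continuous_intros) (use * in \<open>force simp: complex_eq_iff\<close>)+
qed

text \<open>The binomial series of \<open>(1 + u) powr (- s - j)\<close> contributes
  \<open>(s + j)_(M - j)\<close>, and \<open>(s)_j * (s + j)_(M - j) = (s)_M\<close> is independent
  of \<open>j\<close>. What remains is the Euler recurrence: zero for \<open>M > 0\<close>, while
  for \<open>M = 0\<close> its value \<open>2\<close>, halved, cancels the
  \<open>- 1\<close>.\<close>

lemma boole_defect_coeff:
  assumes "M < N"
  shows "(deriv ^^ M) (boole_defect N s) 0 = 0"
proof -
  define F :: "complex fps" where
    "F = (\<Sum>j<N. fps_const (euler_coeff j * (-1) ^ j * pochhammer s j) *
            (fps_X ^ j * (1 + fps_binomial (- s - of_nat j)))) * fps_const (1 / 2) - 1"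
  have "(\<lambda>u. (\<Sum>j<N. euler_coeff j * (-1) ^ j * pochhammer s j *
           (u ^ j * (1 + (1 + u) powr (- s - of_nat j)))) * (1 / 2) - 1) has_fps_expansion F"
    unfolding F_def by (intro fps_expansion_intros)
  hence "boole_defect N s has_fps_expansion F"
    by (simp add: boole_defect_def[abs_def])
  hence 1: "fps_nth F M = (deriv ^^ M) (boole_defect N s) 0 / fact M"
    by (rule fps_nth_fps_expansion)
  have nth: "euler_coeff j * (-1) ^ j * pochhammer s j * fps_nth (fps_X ^ j * (1 + fps_binomial (- s - of_nat j))) M
     = (-1) ^ M * pochhammer s M * ((if j \<le> M then euler_coeff j / fact (M - j) else 0) + (if j = M then euler_coeff j else 0))" for j
  proof (cases "j \<le> M")
    case True
    define i where "i = M - j"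
    have M: "M = j + i" using True by (simp add: i_def)
    have "fps_nth (fps_X ^ j * (1 + fps_binomial (- s - of_nat j))) M =
            (if i = 0 then 1 else 0) + (-1) ^ i * pochhammer (s + of_nat j) i / fact i"
      by (simp add: M fps_X_power_mult_nth gbinomial_pochhammer add.commute)
    thus ?thesis
      by (cases "i = 0") (simp_all add: M pochhammer_product' power_add ring_distribs)
  qed (auto simp: fps_X_power_mult_nth)
  \<comment> \<open>Because \<open>M < N\<close>, the truncation loses no index
    \<open>j <= M\<close> and the full recurrence appears.\<close>
  have "(\<Sum>j<N. (if j \<le> M then euler_coeff j / fact (M - j) else 0)) = (\<Sum>j\<le>M. euler_coeff j / fact (M - j))"
    using assms by (intro sum.mono_neutral_cong_right) auto
  hence "(\<Sum>j<N. euler_coeff j * (-1) ^ j * pochhammer s j * fps_nth (fps_X ^ j * (1 + fps_binomial (- s - of_nat j))) M)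
    = (-1) ^ M * pochhammer s M * ((\<Sum>j\<le>M. euler_coeff j / fact (M - j)) + euler_coeff M)"
    using assms unfolding nth by (simp add: sum.distrib flip: sum_distrib_left)
  also have "\<dots> = (if M = 0 then 2 else 0)"
    by (simp add: euler_coeff_recurrence)
  finally have "fps_nth F M = 0"
    unfolding F_def
    by (simp only: fps_sub_nth fps_mult_right_const_nth fps_sum_nth fps_mult_left_const_nth) simp
  thus ?thesis using 1 by simp
qed

text \<open>Compactness gives a bound \<open>B\<close> on \<open>|u| <= 1/2\<close>, and Cauchy's
  inequality bounds the Taylor coefficients by \<open>B * 2^M\<close>. The first \<open>N\<close>
  vanish, so a geometric series of ratio \<open>2 |u| <= 1/2\<close> remains; hence the constant
  \<open>2 * B * 2^N\<close>.\<close>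

lemma boole_defect_bound:
  "\<exists>C\<ge>0. \<forall>s u. norm s \<le> S \<longrightarrow> norm u \<le> 1/4 \<longrightarrow> norm (boole_defect N s u) \<le> C * norm u ^ N"
proof -
  have "compact (cball 0 S \<times> cball 0 (1/2) :: (complex \<times> complex) set)"
    by (intro compact_Times compact_cball)
  hence "compact ((\<lambda>(s, u). boole_defect N s u) ` (cball 0 S \<times> cball 0 (1/2)))"
    by (rule compact_continuous_image[rotated])
       (rule continuous_on_subset[OF boole_defect_continuous], auto)
  then obtain B where B0: "B > 0"
    and B: "\<And>s u. norm s \<le> S \<Longrightarrow> norm u \<le> 1/2 \<Longrightarrow> norm (boole_defect N s u) \<le> B"
    by (auto dest!: compact_imp_bounded simp: bounded_pos)
  have "norm (boole_defect N s u) \<le> (2 * B * 2 ^ N) * norm u ^ N" if s: "norm s \<le> S" and u: "norm u \<le> 1/4" for s u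
  proof -
    let ?a = "\<lambda>M. (deriv ^^ M) (boole_defect N s) 0 / fact M * u ^ M"
    let ?q = "2 * norm u"
    have "?a sums boole_defect N s u"
      using holomorphic_power_series[OF boole_defect_holomorphic[of N s], of u] u by simp
    hence "(\<lambda>M. ?a (M + N)) sums (boole_defect N s u - (\<Sum>M<N. ?a M))"
      by (rule sums_split_initial_segment)
    hence a: "(\<lambda>M. ?a (M + N)) sums boole_defect N s u"
      by (simp add: boole_defect_coeff)
    have le: "norm (?a M) \<le> B * ?q ^ M" for M
    proof -
      have "norm ((deriv ^^ M) (boole_defect N s) 0) \<le> fact M * B / (1/2) ^ M"
      proof (rule Cauchy_inequality)
        show "boole_defect N s holomorphic_on ball 0 (1/2)"
          by (rule holomorphic_on_subset[OF boole_defect_holomorphic]) auto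
        show "continuous_on (cball 0 (1/2)) (boole_defect N s)"
          by (rule holomorphic_on_imp_continuous_on, rule holomorphic_on_subset[OF boole_defect_holomorphic]) auto
      qed (use B s in auto)
      hence "norm ((deriv ^^ M) (boole_defect N s) 0) / fact M \<le> B * 2 ^ M"
        by (simp add: field_simps)
      from mult_right_mono[OF this, of "norm u ^ M"] show ?thesis
        by (simp add: norm_mult norm_divide norm_power power_mult_distrib mult.assoc)
    qed
    have q: "?q \<le> 1/2" "?q \<ge> 0" using u by auto
    have g: "(\<lambda>M. B * ?q ^ N * ?q ^ M) sums (B * ?q ^ N * (1 / (1 - ?q)))"
      by (intro sums_mult geometric_sums) (use q in auto)
    have "norm (\<Sum>M. ?a (M + N)) \<le> (\<Sum>M. B * ?q ^ N * ?q ^ M)"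
      using le[of "_ + N"] g
      by (intro norm_suminf_le) (auto simp: power_add sums_iff mult_ac)
    hence "norm (boole_defect N s u) \<le> B * ?q ^ N * (1 / (1 - ?q))"
      using a g by (simp add: sums_iff)
    also have "\<dots> \<le> B * ?q ^ N * 2"
      using q B0 by (intro mult_left_mono) (auto simp: field_simps)
    finally show ?thesis by (simp add: power_mult_distrib mult_ac)
  qed
  thus ?thesis
    by (intro exI[of _ "2 * B * 2 ^ N"]) (use B0 in auto)
qed

section \<open>Analytic continuation\<close>

text \<open>Expand \<open>|q + k|^2 = |q|^2 + 2 k Re q + k^2\<close> and use
  \<open>Re q >= - cos \<delta> * |q|\<close>, which holds throughout the sector.\<close>

lemma sector_add_nat_bound:
  assumes "\<delta> > 0"
  shows "\<exists>c>0. \<forall>q\<in>sector \<delta>. \<forall>k. c * (norm q + real k) \<le> norm (q + of_nat k)"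
proof (cases "\<delta> \<le> pi")
  case False
  hence "sector \<delta> = {}" by (auto simp: sector_def)
  thus ?thesis by (intro exI[of _ 1]) auto
next
  case True
  have cos: "cos \<delta> < 1"
    using cos_monotone_0_pi[of 0 \<delta>] assms True by simp
  \<comment> \<open>For \<open>0 < \<delta> <= pi\<close> this is
    \<open>sin (\<delta> / 2)\<close>.\<close>
  define c where "c = sqrt ((1 - cos \<delta>) / 2)"
  have c: "c > 0" "c\<^sup>2 = (1 - cos \<delta>) / 2" using cos by (auto simp: c_def)
  have "c * (norm q + real k) \<le> norm (q + of_nat k)" if q: "q \<in> sector \<delta>" for q k
  proof -
    have q0: "q \<noteq> 0" and arg: "\<bar>Arg q\<bar> \<le> pi - \<delta>" using q by (auto simp: sector_def)
    have "cos (pi - \<delta>) \<le> cos \<bar>Arg q\<bar>"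
      using arg assms by (intro cos_monotone_0_pi_le) auto
    hence "- cos \<delta> \<le> Re q / norm q"
      using q0 by (simp add: cos_Arg)
    hence re: "- cos \<delta> * norm q \<le> Re q"
      using q0 by (simp add: field_simps)
    \<comment> \<open>The two sides differ by
      \<open>(1 + cos \<delta>) / 2 * (norm q - k)^2\<close>.\<close>
    have "(1 - cos \<delta>) / 2 * (norm q + k)\<^sup>2 \<le> (norm q)\<^sup>2 - 2 * cos \<delta> * norm q * k + (real k)\<^sup>2"
    proof -
      have "0 \<le> 1 + cos \<delta>" using cos_ge_minus_one[of \<delta>] by linarith
      hence "0 \<le> (1 + cos \<delta>) / 2 * (norm q - k)\<^sup>2" by simp
      thus ?thesis by (simp add: power2_eq_square field_simps)
    qed
    also have "\<dots> \<le> (norm q)\<^sup>2 + 2 * Re q * k + (real k)\<^sup>2"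
      using mult_right_mono[OF re, of k] by (simp add: mult_ac)
    also have "\<dots> = (norm (q + of_nat k))\<^sup>2"
      unfolding cmod_power2 by (simp add: power2_eq_square algebra_simps)
    finally have "(c * (norm q + k))\<^sup>2 \<le> (norm (q + of_nat k))\<^sup>2"
      by (simp add: power_mult_distrib c)
    thus ?thesis by (rule power2_le_imp_le) simp
  qed
  thus ?thesis using c(1) by blast
qed

lemma Arg_less_pi_iff:
  assumes "q \<noteq> 0"
  shows "\<bar>Arg q\<bar> < pi \<longleftrightarrow> q \<notin> \<real>\<^sub>\<le>\<^sub>0"
proof -
  have "\<bar>Arg q\<bar> < pi \<longleftrightarrow> Arg q \<noteq> pi"
    using mpi_less_Arg[of q] Arg_le_pi[of q] by auto
  also have "\<dots> \<longleftrightarrow> q \<notin> \<real>\<^sub>\<le>\<^sub>0"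
    using assms by (auto simp: Arg_eq_pi complex_nonpos_Reals_iff complex_eq_iff)
  finally show ?thesis .
qed

lemma sector_nonpos_Reals:
  assumes "\<delta> > 0" "q \<in> sector \<delta>"
  shows "q \<notin> \<real>\<^sub>\<le>\<^sub>0"
  using assms Arg_less_pi_iff[of q] by (auto simp: sector_def)

lemma nonpos_Reals_add_nat:
  fixes q :: complex
  assumes "q \<notin> \<real>\<^sub>\<le>\<^sub>0"
  shows "q + of_nat k \<notin> \<real>\<^sub>\<le>\<^sub>0"
  using assms by (auto simp: complex_nonpos_Reals_iff)

text \<open>A fixed \<open>q\<close> off the cut lies in the sector with
  \<open>\<delta> = pi - |Arg q|\<close>. The constant may depend on \<open>q\<close>, which
  suffices for continuation in \<open>s\<close>.\<close>

lemma nonpos_Reals_add_nat_bound: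
  fixes q :: complex
  assumes "q \<notin> \<real>\<^sub>\<le>\<^sub>0"
  shows "\<exists>c>0. \<forall>k. c * (norm q + real k) \<le> norm (q + of_nat k)"
proof -
  have q0: "q \<noteq> 0" using assms by auto
  hence "\<bar>Arg q\<bar> < pi" using assms Arg_less_pi_iff by blast
  hence "pi - \<bar>Arg q\<bar> > 0" "q \<in> sector (pi - \<bar>Arg q\<bar>)"
    using q0 by (auto simp: sector_def)
  thus ?thesis using sector_add_nat_bound by blast
qed

lemma norm_powr_le:
  fixes x s :: complex
  shows "norm (x powr s) \<le> exp (pi * norm s) * norm x powr Re s"
proof -
  have "- Im s * Arg x \<le> \<bar>Im s\<bar> * \<bar>Arg x\<bar>"
    by (metis abs_ge_minus_self abs_mult minus_mult_left)
  also have "\<dots> \<le> norm s * pi"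
    using mpi_less_Arg[of x] Arg_le_pi[of x] by (intro mult_mono abs_Im_le_cmod) auto
  finally have "exp (- Im s * Arg x) \<le> exp (pi * norm s)" by (simp add: mult.commute)
  thus ?thesis
    unfolding norm_powr_complex by (subst mult.commute) (intro mult_right_mono, auto)
qed

text \<open>For \<open>norm x >= 4\<close> the point \<open>u = 1 / x\<close> lies in the disc of
  \<open>boole_defect_bound\<close>, whose factor \<open>|u|^N\<close> gains \<open>N\<close> powers
  of \<open>x\<close>.\<close>

lemma boole_rem_bound:
  "\<exists>C\<ge>0. \<forall>s x. norm s \<le> S \<longrightarrow> norm x \<ge> 4 \<longrightarrow> x \<notin> \<real>\<^sub>\<le>\<^sub>0 \<longrightarrow>
       norm (boole_rem N s x) \<le> C * norm x powr (- Re s - real N)"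
proof -
  obtain C where C: "C \<ge> 0"
    "\<And>s u. norm s \<le> S \<Longrightarrow> norm u \<le> 1/4 \<Longrightarrow> norm (boole_defect N s u) \<le> C * norm u ^ N"
    using boole_defect_bound[of S N] by blast
  show ?thesis
  proof (intro exI conjI allI impI)
    show "exp (pi * S) * C \<ge> 0" using C(1) by simp
  next
    fix s x :: complex
    assume *: "norm s \<le> S" "norm x \<ge> 4" "x \<notin> \<real>\<^sub>\<le>\<^sub>0"
    have "exp (pi * norm (-s)) * norm x powr Re (-s) \<le> exp (pi * S) * norm x powr (- Re s)"
      using * by (intro mult_mono) auto
    hence 1: "norm (x powr (-s)) \<le> exp (pi * S) * norm x powr (- Re s)"
      using norm_powr_le[of x "-s"] by linarith
    have 2: "norm (boole_defect N s (1 / x)) \<le> C * norm (1 / x) ^ N"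
      using * by (intro C) (auto simp: norm_divide divide_le_eq)
    have "norm (boole_rem N s x) \<le> (exp (pi * S) * norm x powr (- Re s)) * (C * norm (1 / x) ^ N)"
      unfolding boole_rem_eq[OF *(3)] norm_mult by (intro mult_mono 1 2) auto
    also have "norm (1 / x) ^ N = norm x powr (- real N)"
    proof -
      have "norm x > 0" using *(2) by linarith
      thus ?thesis by (simp add: norm_divide powr_minus powr_realpow power_one_over inverse_eq_divide)
    qed
    also have "exp (pi * S) * norm x powr (- Re s) * (C * norm x powr (- real N)) =
        exp (pi * S) * C * norm x powr (- Re s - real N)"
      by (simp flip: powr_add)
    finally show "norm (boole_rem N s x) \<le> exp (pi * S) * C * norm x powr (- Re s - real N)" .
  qed
qed

lemma boole_main_holomorphic [holomorphic_intros]: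
  "(\<lambda>s. boole_main N s u) holomorphic_on A"
  unfolding boole_main_def by (intro holomorphic_intros) auto

lemma boole_rem_holomorphic [holomorphic_intros]:
  "(\<lambda>s. boole_rem N s x) holomorphic_on A"
  unfolding boole_rem_def by (intro holomorphic_intros)

text \<open>The exponent \<open>- Re s - N\<close> is at most \<open>-2\<close>, so
  \<open>|q + k| >= c * k\<close> yields a majorant of order \<open>1 / k^2\<close>. It holds only
  eventually because \<open>boole_rem_bound\<close> needs \<open>|q + k| >= 4\<close>.\<close>

lemma boole_rem_majorant:
  assumes "q \<notin> \<real>\<^sub>\<le>\<^sub>0"
  shows "\<exists>M. summable M \<and> eventually (\<lambda>k. \<forall>s. norm s \<le> S \<and> Re s \<ge> 2 - real N \<longrightarrow>
       norm ((-1) ^ k * boole_rem N s (q + of_nat k)) \<le> M k) sequentially"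
proof -
  obtain c where c: "c > 0" "\<And>k. c * (norm q + real k) \<le> norm (q + of_nat k)"
    using nonpos_Reals_add_nat_bound[OF assms] by blast
  obtain C where C: "C \<ge> 0"
    "\<And>s x. norm s \<le> S \<Longrightarrow> norm x \<ge> 4 \<Longrightarrow> x \<notin> \<real>\<^sub>\<le>\<^sub>0 \<Longrightarrow>
       norm (boole_rem N s x) \<le> C * norm x powr (- Re s - real N)"
    using boole_rem_bound[of S N] by blast
  show ?thesis
  proof (intro exI conjI)
    show "summable (\<lambda>k. C / c\<^sup>2 * inverse (real k ^ 2))"
      by (intro summable_mult inverse_power_summable) auto
    have "eventually (\<lambda>k. real k \<ge> 4 / c) sequentially"
      by (rule eventually_compose_filterlim[OF eventually_ge_at_top filterlim_real_sequentially])
    thus "eventually (\<lambda>k. \<forall>s. norm s \<le> S \<and> Re s \<ge> 2 - real N \<longrightarrow>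
       norm ((-1) ^ k * boole_rem N s (q + of_nat k)) \<le> C / c\<^sup>2 * inverse (real k ^ 2)) sequentially"
    proof eventually_elim
      case (elim k)
      let ?x = "q + of_nat k"
      have k: "real k > 0" using elim c(1) by (smt (verit) divide_pos_pos)
      have "4 \<le> c * real k" using elim c(1) by (simp add: field_simps)
      moreover have le: "c * real k \<le> norm ?x"
        using c(2)[of k] c(1) by (smt (verit) mult_left_mono norm_ge_zero)
      ultimately have x4: "norm ?x \<ge> 4" by linarith
      show ?case
      proof safe
        fix s assume s: "norm s \<le> S" "Re s \<ge> 2 - real N"
        have "norm ((-1) ^ k * boole_rem N s ?x) \<le> C * norm ?x powr (- Re s - real N)"
          using C(2)[OF s(1) x4 nonpos_Reals_add_nat[OF assms]] by (simp add: norm_mult norm_power)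
        also have "\<dots> \<le> C * norm ?x powr (- 2)"
          using s x4 C(1) by (intro mult_left_mono powr_mono) auto
        also have "\<dots> = C * inverse (norm ?x ^ 2)"
          using x4 by (subst powr_minus) (auto simp: powr_numeral)
        also have "\<dots> \<le> C * inverse ((c * real k) ^ 2)"
          using le c(1) k C(1) by (intro mult_left_mono le_imp_inverse_le power_mono) auto
        finally show "norm ((-1) ^ k * boole_rem N s ?x) \<le> C / c\<^sup>2 * inverse (real k ^ 2)"
          by (simp add: power_mult_distrib divide_inverse mult_ac)
      qed
    qed
  qed
qed

section \<open>The remainder series and continuation to a half-plane\<close>

definition boole_tail :: "nat \<Rightarrow> complex \<Rightarrow> complex \<Rightarrow> complex" where
  "boole_tail N s q = (\<Sum>k. (-1) ^ k * boole_rem N s (q + of_nat k))"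

lemma boole_tail_summable:
  assumes "q \<notin> \<real>\<^sub>\<le>\<^sub>0" "Re s \<ge> 2 - real N"
  shows "summable (\<lambda>k. (-1) ^ k * boole_rem N s (q + of_nat k))"
proof -
  obtain M where M: "summable M" "eventually (\<lambda>k. \<forall>z. norm z \<le> norm s \<and> Re z \<ge> 2 - real N \<longrightarrow>
       norm ((-1) ^ k * boole_rem N z (q + of_nat k)) \<le> M k) sequentially"
    using boole_rem_majorant[OF assms(1), of "norm s" N] by blast
  have "eventually (\<lambda>k. norm ((-1) ^ k * boole_rem N s (q + of_nat k)) \<le> M k) sequentially"
    using M(2) by eventually_elim (use assms(2) in blast)
  thus ?thesis
    using M(1) by (rule summable_comparison_test_ev)
qed

lemma boole_tail_holomorphic:
  assumes "q \<notin> \<real>\<^sub>\<le>\<^sub>0"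
  shows "(\<lambda>s. boole_tail N s q) holomorphic_on {s. Re s > 2 - real N}"
proof (rule holomorphic_uniform_sequence)
  show "open {s. Re s > 2 - real N}"
    by (rule open_halfspace_Re_gt)
  show "(\<lambda>s. \<Sum>k<n. (-1) ^ k * boole_rem N s (q + of_nat k)) holomorphic_on {s. Re s > 2 - real N}" for n
    by (intro holomorphic_intros)
next
  fix x assume x: "x \<in> {s. Re s > 2 - real N}"
  \<comment> \<open>Half the distance to the boundary line, so the closed disc stays inside the
    half-plane.\<close>
  define d where "d = (Re x - (2 - real N)) / 2"
  have d: "d > 0" using x by (simp add: d_def)
  have re: "Re s > 2 - real N" if "s \<in> cball x d" for s
  proof -
    have "\<bar>Re (x - s)\<bar> \<le> d" using that abs_Re_le_cmod[of "x - s"] by (simp add: dist_norm)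
    hence "Re x - Re s \<le> d" by simp
    moreover have "2 * d = Re x - (2 - real N)" by (simp add: d_def)
    ultimately show ?thesis using d by linarith
  qed
  have nrm: "norm s \<le> norm x + d" if "s \<in> cball x d" for s
    using that norm_triangle_sub[of s x] by (simp add: dist_norm norm_minus_commute)
  obtain M where M: "summable M" "eventually (\<lambda>k. \<forall>s. norm s \<le> norm x + d \<and> Re s \<ge> 2 - real N \<longrightarrow>
       norm ((-1) ^ k * boole_rem N s (q + of_nat k)) \<le> M k) sequentially"
    using boole_rem_majorant[OF assms, of "norm x + d" N] by blast
  have "uniform_limit (cball x d) (\<lambda>n s. \<Sum>k<n. (-1) ^ k * boole_rem N s (q + of_nat k))
          (\<lambda>s. \<Sum>k. (-1) ^ k * boole_rem N s (q + of_nat k)) sequentially"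
  proof (rule Weierstrass_m_test_ev[OF _ M(1)])
    show "\<forall>\<^sub>F k in sequentially. \<forall>s\<in>cball x d.
            norm ((-1) ^ k * boole_rem N s (q + of_nat k)) \<le> M k"
      using M(2) by eventually_elim (use nrm re less_imp_le in blast)
  qed
  thus "\<exists>d>0. cball x d \<subseteq> {s. Re s > 2 - real N} \<and>
          uniform_limit (cball x d) (\<lambda>n s. \<Sum>k<n. (-1) ^ k * boole_rem N s (q + of_nat k))
            (\<lambda>s. boole_tail N s q) sequentially"
    using d re unfolding boole_tail_def by blast
qed

definition boole_zeta :: "nat \<Rightarrow> complex \<Rightarrow> complex \<Rightarrow> complex" where
  "boole_zeta N q s = q powr (-s) * boole_main N s (1 / q) - boole_tail N s q"

lemma boole_zeta_holomorphic:
  assumes "q \<notin> \<real>\<^sub>\<le>\<^sub>0"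
  shows "boole_zeta N q holomorphic_on {s. Re s > 2 - real N}"
  unfolding boole_zeta_def
  by (intro holomorphic_intros boole_tail_holomorphic assms)

text \<open>With \<open>h k\<close> the signed Boole sum at \<open>q + k\<close>, the difference
  \<open>h k - h (Suc k)\<close> is the original term plus the signed remainder, and it telescopes.
  \<open>Re s > 0\<close> gives \<open>h k -> 0\<close>; \<open>N >= 2\<close> makes the remainder
  series converge for every such \<open>s\<close>.\<close>

lemma boole_zeta_sums:
  assumes q: "q \<notin> \<real>\<^sub>\<le>\<^sub>0" and s: "Re s > 0" and N: "N \<ge> 2"
  shows "(\<lambda>k. (-1) ^ k / (of_nat k + q) powr s) sums boole_zeta N q s"
proof -
  define h where "h k = (-1) ^ k * ((q + of_nat k) powr (-s) * boole_main N s (1 / (q + of_nat k)))" for k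
  have inf: "filterlim (\<lambda>k. q + of_nat k) at_infinity sequentially"
    by (intro tendsto_add_filterlim_at_infinity[OF tendsto_const] tendsto_of_nat)
  hence inv: "(\<lambda>k. 1 / (q + of_nat k)) \<longlonglongrightarrow> 0"
    by (intro tendsto_divide_0[OF tendsto_const])
  have nrm: "filterlim (\<lambda>k. norm (q + of_nat k)) at_top sequentially"
    using inf by (rule filterlim_at_infinity_imp_norm_at_top)
  have "(\<lambda>k. exp (pi * norm (-s)) * norm (q + of_nat k) powr Re (-s)) \<longlonglongrightarrow> exp (pi * norm (-s)) * 0"
    by (rule tendsto_mult[OF tendsto_const tendsto_neg_powr[OF _ nrm]]) (use s in simp)
  hence "(\<lambda>k. (q + of_nat k) powr (-s)) \<longlonglongrightarrow> 0"
    by (intro Lim_null_comparison[OF always_eventually[OF allI[OF norm_powr_le]]]) simp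
  moreover have "(\<lambda>k. boole_main N s (1 / (q + of_nat k))) \<longlonglongrightarrow> boole_main N s 0"
    unfolding boole_main_def by (intro tendsto_intros inv) simp
  ultimately have "(\<lambda>k. (q + of_nat k) powr (-s) * boole_main N s (1 / (q + of_nat k))) \<longlonglongrightarrow> 0 * boole_main N s 0"
    by (rule tendsto_mult)
  hence "(\<lambda>k. norm (h k)) \<longlonglongrightarrow> norm (0 :: complex)"
    using tendsto_norm by (fastforce simp: h_def norm_mult norm_power)
  hence "h \<longlonglongrightarrow> 0"
    by (simp add: tendsto_norm_zero_iff)
  hence "(\<lambda>k. h k - h (Suc k)) sums (h 0 - 0)"
    by (rule telescope_sums')
  moreover have "(\<lambda>k. (-1) ^ k * boole_rem N s (q + of_nat k)) sums boole_tail N s q"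
    unfolding boole_tail_def using boole_tail_summable[OF q] s N by (intro summable_sums) auto
  ultimately have "(\<lambda>k. h k - h (Suc k) - (-1) ^ k * boole_rem N s (q + of_nat k)) sums (h 0 - 0 - boole_tail N s q)"
    by (rule sums_diff)
  moreover have "h k - h (Suc k) - (-1) ^ k * boole_rem N s (q + of_nat k) = (-1) ^ k / (of_nat k + q) powr s" for k
    by (simp add: h_def boole_rem_def powr_minus algebra_simps divide_inverse)
  ultimately show ?thesis by (simp add: h_def boole_zeta_def)
qed

section \<open>Uniqueness and the entire continuation\<close>

lemma holomorphic_eq_right_half_plane:
  assumes "f holomorphic_on {s. Re s > a}" "g holomorphic_on {s. Re s > a}"
    and "\<And>s. Re s > b \<Longrightarrow> f s = g s" and "Re s > a"
  shows "f s = g s"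
proof (rule analytic_continuation_open[of "{s. Re s > max a b}" "{s. Re s > a}" f g])
  show "{s. Re s > max a b} \<noteq> {}"
  proof -
    have "of_real (max a b + 1) \<in> {s. Re s > max a b}"
      by (simp only: mem_Collect_eq Re_complex_of_real)
    thus ?thesis by blast
  qed
  show "connected {s. Re s > a}"
    by (intro convex_connected convex_halfspace_Re_gt)
  show "open {s. Re s > max a b}" "open {s. Re s > a}"
    by (rule open_halfspace_Re_gt)+
qed (use assms in auto)

lemma entire_eq_right_half_plane:
  assumes "f holomorphic_on UNIV" "g holomorphic_on UNIV" "\<And>s. Re s > b \<Longrightarrow> f s = g s"
  shows "f = g"
proof (rule ext)
  fix s :: complex
  show "f s = g s"
    by (rule holomorphic_eq_right_half_plane[of f "Re s - 1" g b])
       (use assms in \<open>auto intro: holomorphic_on_subset\<close>)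
qed

lemma boole_zeta_unique:
  assumes q: "q \<notin> \<real>\<^sub>\<le>\<^sub>0" and "2 \<le> N" "N \<le> N'" "Re s > 2 - real N"
  shows "boole_zeta N q s = boole_zeta N' q s"
proof (rule holomorphic_eq_right_half_plane[of "boole_zeta N q" "2 - real N" "boole_zeta N' q" 0 s])
  show "boole_zeta N q holomorphic_on {s. Re s > 2 - real N}"
    by (rule boole_zeta_holomorphic[OF q])
  show "boole_zeta N' q holomorphic_on {s. Re s > 2 - real N}"
    by (rule holomorphic_on_subset[OF boole_zeta_holomorphic[OF q]]) (use assms in auto)
  show "boole_zeta N q s = boole_zeta N' q s" if "Re s > 0" for s
    using boole_zeta_sums[OF q that, of N] boole_zeta_sums[OF q that, of N'] assms(2,3)
    by (auto intro: sums_unique2)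
qed (use assms in auto)

text \<open>The continuations to growing half-planes agree on overlaps and glue to one entire
  function; by the identity theorem it is the one that the definite description denotes.\<close>

lemma alt_hurwitz_zeta:
  assumes q: "q \<notin> \<real>\<^sub>\<le>\<^sub>0"
  shows "(\<lambda>s. alt_hurwitz_zeta s q) holomorphic_on UNIV"
    and "N \<ge> 2 \<Longrightarrow> Re s > 2 - real N \<Longrightarrow> alt_hurwitz_zeta s q = boole_zeta N q s"
proof -
  \<comment> \<open>The order varies with \<open>s\<close>; adding \<open>3\<close> makes it at
    least \<open>2\<close> and secures the strict inequality \<open>Re s > 2 - N\<close>.\<close>
  define f where "f s = boole_zeta (nat \<lceil>2 - Re s\<rceil> + 3) q s" for s
  have f: "f s = boole_zeta N q s" if "N \<ge> 2" "Re s > 2 - real N" for N s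
  proof -
    let ?N = "nat \<lceil>2 - Re s\<rceil> + 3"
    have N: "Re s > 2 - real ?N" "?N \<ge> 2" by linarith+
    show ?thesis
    proof (cases "N \<le> ?N")
      case True
      thus ?thesis unfolding f_def using boole_zeta_unique[OF q that(1) _ that(2), of ?N] by simp
    next
      case False
      thus ?thesis unfolding f_def using boole_zeta_unique[OF q N(2) _ N(1), of N] by simp
    qed
  qed
  \<comment> \<open>On each half-plane \<open>f\<close> equals a single \<open>boole_zeta\<close> of
    fixed order, although its defining order jumps with \<open>s\<close>.\<close>
  have hol: "f holomorphic_on {s. Re s > 2 - real (n + 2)}" for n
    using holomorphic_cong[OF refl, of "{s. Re s > 2 - real (n + 2)}" f "boole_zeta (n + 2) q"]
      f[of "n + 2"] boole_zeta_holomorphic[OF q, of "n + 2"] by simp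
  have "f holomorphic_on (\<Union>n. {s. Re s > 2 - real (n + 2)})"
    using hol open_halfspace_Re_gt by (intro holomorphic_on_UN_open) auto
  moreover have "(\<Union>n. {s. Re s > 2 - real (n + 2)}) = UNIV"
  proof safe
    fix s :: complex
    obtain n where "- Re s < real n" using reals_Archimedean2 by blast
    thus "s \<in> (\<Union>n. {s. Re s > 2 - real (n + 2)})" by (auto intro!: exI[of _ n])
  qed auto
  ultimately have hol: "f holomorphic_on UNIV" by simp
  have sums: "(\<lambda>n. (-1) ^ n / (of_nat n + q) powr z) sums f z" if "Re z > 0" for z
    using boole_zeta_sums[OF q that, of 2] f[of 2 z] that by simp
  have "alt_hurwitz_zeta s q = f s" for s
  proof -
    have "(THE f. f holomorphic_on UNIV \<and> (\<forall>z. Re z > 0 \<longrightarrow> (\<lambda>n. (-1) ^ n / (of_nat n + q) powr z) sums f z)) = f"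
    proof (rule the_equality)
      fix g assume "g holomorphic_on UNIV \<and> (\<forall>z. Re z > 0 \<longrightarrow> (\<lambda>n. (-1) ^ n / (of_nat n + q) powr z) sums g z)"
      thus "g = f"
        using hol sums by (intro entire_eq_right_half_plane[of g f 0]) (auto intro: sums_unique2)
    qed (use hol sums in auto)
    thus ?thesis by (simp add: alt_hurwitz_zeta_def)
  qed
  thus "(\<lambda>s. alt_hurwitz_zeta s q) holomorphic_on UNIV"
    and "N \<ge> 2 \<Longrightarrow> Re s > 2 - real N \<Longrightarrow> alt_hurwitz_zeta s q = boole_zeta N q s"
    using hol f by auto
qed

section \<open>Derivatives of Pochhammer symbols\<close>

text \<open>Vandermonde's convolution: the coefficients in
  \<open>(1 - x)^(-s-t) = (1 - x)^(-s) * (1 - x)^(-t)\<close>.\<close>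

lemma pochhammer_divide_fact_add:
  fixes s t :: complex
  shows "pochhammer (s + t) j / fact j =
    (\<Sum>i\<le>j. pochhammer s i / fact i * (pochhammer t (j - i) / fact (j - i)))"
  unfolding pochhammer_binomial_sum sum_divide_distrib
  by (intro sum.cong refl) (auto simp: binomial_fact field_simps)

text \<open>For \<open>j > 0\<close> split off the factor \<open>t\<close> that vanishes at
  \<open>0\<close>; the cofactor there is \<open>(j - 1)!\<close>, and
  \<open>(j - 1)! / j! = 1 / j\<close>.\<close>

lemma deriv_pochhammer_0: "((\<lambda>t :: complex. pochhammer t j / fact j) has_field_derivative
    (if j = 0 then 0 else 1 / of_nat j)) (at 0)"
proof (cases j)
  case (Suc i)
  have "(\<lambda>t. pochhammer (t + 1) i) field_differentiable at (0 :: complex)"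
    by (rule holomorphic_on_imp_differentiable_at[of _ UNIV]) (auto intro!: holomorphic_intros)
  then obtain D where D: "((\<lambda>t. pochhammer (t + 1) i) has_field_derivative D) (at (0 :: complex))"
    unfolding field_differentiable_def by blast
  have "((\<lambda>t :: complex. t * pochhammer (t + 1) i / fact (Suc i)) has_field_derivative
     (1 * pochhammer (0 + 1) i + D * 0) / fact (Suc i)) (at 0)"
    by (intro DERIV_cdivide DERIV_mult DERIV_ident D)
  thus ?thesis
    by (simp add: Suc pochhammer_rec pochhammer_fact[symmetric] del: of_nat_Suc)
qed auto

text \<open>Differentiate the Vandermonde identity for \<open>pochhammer (s + t) j\<close> at \<open>t = 0\<close>.\<close>
lemma deriv_pochhammer_divide_fact:
  fixes s :: complex
  shows "((\<lambda>s. pochhammer s j / fact j) has_field_derivative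
    (\<Sum>i<j. 1 / of_nat (j - i) * (pochhammer s i / fact i))) (at s)"
proof -
  have "((\<lambda>t. \<Sum>i\<le>j. pochhammer s i / fact i * (pochhammer t (j - i) / fact (j - i)))
     has_field_derivative (\<Sum>i\<le>j. pochhammer s i / fact i * (if j - i = 0 then 0 else 1 / of_nat (j - i)))) (at 0)"
    by (intro DERIV_sum DERIV_cmult deriv_pochhammer_0)
  also have "(\<Sum>i\<le>j. pochhammer s i / fact i * (if j - i = 0 then 0 else 1 / of_nat (j - i)))
     = (\<Sum>i<j. 1 / of_nat (j - i) * (pochhammer s i / fact i))"
    by (intro sum.mono_neutral_cong_right) auto
  finally have "((\<lambda>t. pochhammer (s + t) j / fact j) has_field_derivative
     (\<Sum>i<j. 1 / of_nat (j - i) * (pochhammer s i / fact i))) (at 0)"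
    by (simp only: pochhammer_divide_fact_add)
  thus ?thesis
    using DERIV_at_within_shift[of "\<lambda>s. pochhammer s j / fact j" _ s 0 UNIV] by (simp add: add.commute)
qed

text \<open>\<open>nested_coeff m j s\<close> is the coefficient of \<open>x\<^sup>j\<close> in \<open>(- log (1 - x))\<^sup>m (1 - x) powr (- s)\<close>, the
  \<open>m\<close>-th \<open>s\<close>-derivative of the generating function of \<open>pochhammer s j / fact j\<close>.\<close>
fun nested_coeff :: "nat \<Rightarrow> nat \<Rightarrow> complex \<Rightarrow> complex" where
  "nested_coeff 0 j s = pochhammer s j / fact j"
| "nested_coeff (Suc m) j s = (\<Sum>i<j. 1 / of_nat (j - i) * nested_coeff m i s)"

lemma higher_deriv_pochhammer:
  "(deriv ^^ m) (\<lambda>s. pochhammer s j / fact j) = nested_coeff m j"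
proof -
  \<comment> \<open>The weights do not depend on \<open>s\<close>, so the derivative passes to the
    innermost Pochhammer quotient and adds one more level there.\<close>
  have D: "(nested_coeff m j has_field_derivative nested_coeff (Suc m) j s) (at s)" for m j s
  proof (induction m arbitrary: j)
    case 0
    thus ?case using deriv_pochhammer_divide_fact[of j s] by (simp add: fun_eq_iff)
  next
    case (Suc m)
    show ?case
      unfolding nested_coeff.simps(2)[abs_def] by (intro DERIV_sum DERIV_cmult Suc.IH[unfolded nested_coeff.simps])
  qed
  show ?thesis
  proof (induction m)
    case (Suc m)
    have "deriv (nested_coeff m j) = nested_coeff (Suc m) j"
      using D by (intro ext DERIV_imp_deriv)
    thus ?case by (simp only: funpow.simps o_apply Suc.IH)
  qed (auto simp: fun_eq_iff)
qed

text \<open>Each of the \<open>m\<close> summations lowers the index by at least one; equivalently,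
  \<open>(- log (1 - x))^m\<close> vanishes to order \<open>m\<close> at \<open>0\<close>.\<close>

lemma nested_coeff_eq_0: "j < m \<Longrightarrow> nested_coeff m j s = 0"
  by (induction m arbitrary: j) auto

text \<open>At \<open>s = -n\<close> the quotient \<open>pochhammer s i / fact i\<close> is
  \<open>(-1)^i * (n choose i)\<close>, which vanishes for \<open>i > n\<close>; hence the
  restriction \<open>i <= n\<close> in the innermost sum.\<close>

lemma nested_coeff_eq_nested_sum:
  "nested_coeff (Suc r) j (- of_nat n) = nested_sum n r j"
proof (induction r arbitrary: j)
  case 0
  have "nested_coeff 0 i (- of_nat n) = of_nat (n choose i) * (-1) ^ i" for i
    using gbinomial_pochhammer[of "of_nat n :: complex" i]
    by (simp add: binomial_gbinomial mult_ac flip: power_mult_distrib)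
  thus ?case
    by (auto intro!: sum.mono_neutral_cong_right simp: binomial_eq_0)
next
  case (Suc r)
  thus ?case by (simp only: nested_coeff.simps(2)[of "Suc r"] nested_sum.simps(2))
qed

text \<open>The outermost sum is a further nesting level started from \<open>2 * k + 1\<close>; with
  the \<open>m - 1\<close> levels of \<open>nested_sum n (m - 2)\<close> this makes
  \<open>m\<close>.\<close>

lemma asymp_coeff_eq:
  assumes "m \<ge> 2"
  shows "asymp_coeff m n k = euler_poly (2 * k + 1) 0 * nested_coeff m (2 * k + 1) (- of_nat n)"
proof -
  obtain r where m: "m = Suc (Suc r)" using assms by (metis add_2_eq_Suc le_Suc_ex)
  show ?thesis
    by (simp add: m asymp_coeff_def nested_coeff.simps(2)[of "Suc r"] nested_coeff_eq_nested_sum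
        lessThan_Suc_atMost Suc_diff_le del: nested_coeff.simps)
qed

section \<open>Differentiating the truncated Boole sum in \<open>s\<close>\<close>

lemma higher_deriv_sum_entire:
  fixes f :: "'a \<Rightarrow> complex \<Rightarrow> complex"
  assumes "\<And>j. j \<in> A \<Longrightarrow> f j holomorphic_on UNIV"
  shows "(deriv ^^ m) (\<lambda>s. \<Sum>j\<in>A. f j s) s = (\<Sum>j\<in>A. (deriv ^^ m) (f j) s)"
  using assms
proof (induction A rule: infinite_finite_induct)
  case (insert j A)
  thus ?case
    by (simp add: higher_deriv_add[of _ UNIV] holomorphic_on_sum)
qed auto

lemma higher_deriv_boole_main:
  "(deriv ^^ m) (\<lambda>s. boole_main N s u) s =
     (\<Sum>j<N. (-1) ^ j * euler_poly j 0 * nested_coeff m j s * u ^ j) / 2"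
proof -
  let ?c = "\<lambda>j. (-1) ^ j * euler_poly j 0 * u ^ j / 2"
  have "(deriv ^^ m) (\<lambda>s. boole_main N s u) s = (deriv ^^ m) (\<lambda>s. \<Sum>j<N. ?c j * (pochhammer s j / fact j)) s"
    by (simp add: boole_main_def euler_poly_0 sum_divide_distrib mult_ac)
  also have "\<dots> = (\<Sum>j<N. (deriv ^^ m) (\<lambda>s. ?c j * (pochhammer s j / fact j)) s)"
    by (rule higher_deriv_sum_entire) (auto intro!: holomorphic_intros)
  also have "\<dots> = (\<Sum>j<N. ?c j * nested_coeff m j s)"
    by (intro sum.cong refl, subst higher_deriv_cmult[of _ UNIV]) (auto simp: higher_deriv_pochhammer intro!: holomorphic_intros)
  finally show ?thesis by (simp add: sum_divide_distrib mult_ac)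
qed

text \<open>Indices \<open>0\<close> and \<open>1\<close> drop out because \<open>m >= 2\<close>,
  positive even ones because \<open>E_j(0) = 0\<close>. The odd indices
  \<open>3, ..., 2 * K + 1\<close> remain, with sign \<open>-1\<close>.\<close>

lemma higher_deriv_boole_main_eq:
  assumes "m \<ge> 2"
  shows "(deriv ^^ m) (\<lambda>s. boole_main (2 * K + 3) s u) (- of_nat n) =
     - (\<Sum>k=1..K. u ^ (2 * k + 1) * asymp_coeff m n k) / 2"
proof -
  let ?t = "\<lambda>j. (-1) ^ j * euler_poly j 0 * nested_coeff m j (- of_nat n) * u ^ j"
  have z: "?t j = 0" if "j \<notin> (\<lambda>k. 2 * k + 1) ` {1..K}" "j < 2 * K + 3" for j
  proof (cases "j < 2")
    case True
    thus ?thesis using assms by (simp add: nested_coeff_eq_0)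
  next
    case False
    have "even j"
    proof (rule ccontr)
      assume "odd j"
      then obtain k where "j = 2 * k + 1" by (auto elim: oddE)
      thus False using that False by auto
    qed
    thus ?thesis using False by (simp add: euler_poly_0 euler_coeff_even)
  qed
  have "(\<Sum>j<2 * K + 3. ?t j) = (\<Sum>j\<in>(\<lambda>k. 2 * k + 1) ` {1..K}. ?t j)"
    using z by (intro sum.mono_neutral_right) auto
  also have "\<dots> = (\<Sum>k=1..K. ?t (2 * k + 1))"
    by (subst sum.reindex) (auto simp: inj_on_def)
  also have "\<dots> = - (\<Sum>k=1..K. u ^ (2 * k + 1) * asymp_coeff m n k)"
    unfolding asymp_coeff_eq[OF assms] by (simp add: mult_ac flip: sum_negf)
  finally show ?thesis by (simp add: higher_deriv_boole_main)
qed

section \<open>Asymptotic expansion\<close>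

lemma norm_pochhammer_le:
  fixes s :: complex
  assumes "norm s \<le> S"
  shows "norm (pochhammer s j) \<le> pochhammer S j"
  unfolding pochhammer_prod prod_norm[symmetric]
proof (intro prod_mono conjI)
  fix i
  show "norm (s + of_nat i) \<le> S + of_nat i"
    using norm_triangle_ineq[of s "of_nat i"] assms by simp
qed auto

text \<open>Convergence needs a higher order than the expansion shows; the surplus terms have degree
  at least \<open>M\<close>, so \<open>|u| <= 1\<close> bounds each by a multiple of
  \<open>|u|^M\<close>.\<close>

lemma boole_main_diff_bound:
  assumes "M \<le> N"
  shows "\<exists>D\<ge>0. \<forall>s u. norm s \<le> S \<longrightarrow> norm u \<le> 1 \<longrightarrow>
    norm (boole_main N s u - boole_main M s u) \<le> D * norm u ^ M"
proof -
  define D where "D = (\<Sum>j\<in>{M..<N}. norm (euler_coeff j) * \<bar>pochhammer S j\<bar>)"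
  have "norm (boole_main N s u - boole_main M s u) \<le> D * norm u ^ M"
    if s: "norm s \<le> S" and u: "norm u \<le> 1" for s u
  proof -
    let ?t = "\<lambda>j. euler_coeff j * (-1) ^ j * pochhammer s j * u ^ j"
    have le: "norm (?t j) \<le> norm (euler_coeff j) * \<bar>pochhammer S j\<bar> * norm u ^ M" if "j \<in> {M..<N}" for j
    proof -
      have "norm (pochhammer s j) \<le> \<bar>pochhammer S j\<bar>"
        using norm_pochhammer_le[OF s, of j] by linarith
      moreover have "norm u ^ j \<le> norm u ^ M"
        using that u by (intro power_decreasing) auto
      ultimately show ?thesis
        by (simp add: norm_mult norm_power) (intro mult_mono, auto)
    qed
    have "sum ?t {..<N} - sum ?t {..<M} = sum ?t {M..<N}"
      using sum_diff[of "{..<N}" "{..<M}" ?t] assms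
      by (simp add: ivl_diff[of 0 M N, simplified] flip: atLeast0LessThan)
    hence "boole_main N s u - boole_main M s u = sum ?t {M..<N} / 2"
      by (simp add: boole_main_def flip: diff_divide_distrib)
    hence "norm (boole_main N s u - boole_main M s u) = norm (sum ?t {M..<N}) / 2"
      by (simp only: norm_divide) simp
    also have "\<dots> \<le> norm (sum ?t {M..<N})" by simp
    also have "\<dots> \<le> D * norm u ^ M"
      unfolding D_def sum_distrib_right by (intro sum_norm_le le)
    finally show ?thesis .
  qed
  moreover have "D \<ge> 0" unfolding D_def by (intro sum_nonneg) auto
  ultimately show ?thesis by blast
qed

text \<open>Since \<open>Re s >= - n - 1\<close>, this \<open>N\<close> makes the remainder at
  \<open>q + k\<close> of order \<open>|q + k|^(-2K-6)\<close>. Two powers pay for the sum over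
  \<open>k\<close> and one for \<open>|q powr s| = O(|q|)\<close>, leaving
  \<open>2 * K + 3\<close>.\<close>

lemma boole_tail_bound:
  fixes n K :: nat
  assumes "\<delta> > 0"
  defines "N \<equiv> n + 2 * K + 7"
  shows "\<exists>C\<ge>0. \<exists>R\<ge>1. \<forall>q\<in>sector \<delta>. \<forall>s. norm q \<ge> R \<longrightarrow> norm (s + of_nat n) \<le> 1 \<longrightarrow>
    norm (q powr s * boole_tail N s q) \<le> C * (1 / norm q) ^ (2 * K + 3)"
proof -
  obtain c where c: "c > 0" "\<And>q k. q \<in> sector \<delta> \<Longrightarrow> c * (norm q + real k) \<le> norm (q + of_nat k)"
    using sector_add_nat_bound[OF assms(1)] by blast
  define S where "S = real n + 1"
  obtain C where C: "C \<ge> 0"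
    "\<And>s x. norm s \<le> S \<Longrightarrow> norm x \<ge> 4 \<Longrightarrow> x \<notin> \<real>\<^sub>\<le>\<^sub>0 \<Longrightarrow>
       norm (boole_rem N s x) \<le> C * norm x powr (- Re s - real N)"
    using boole_rem_bound[of S N] by blast
  define T where "T = (\<Sum>k. (1 / (c * real (Suc k))) ^ 2)"
  have "summable (\<lambda>k. inverse (real (Suc k) ^ 2) / c ^ 2)"
    by (intro summable_divide) (subst summable_Suc_iff, intro inverse_power_summable, auto)
  hence sT: "summable (\<lambda>k. (1 / (c * real (Suc k))) ^ 2)"
    by (simp add: power_divide power_mult_distrib divide_inverse power_inverse mult_ac del: of_nat_Suc)
  have T: "T \<ge> 0" unfolding T_def by (intro suminf_nonneg sT) simp
  let ?B = "exp (pi * S) * C * (1 / c) ^ (2 * K + 4) * T"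
  \<comment> \<open>\<open>norm q >= 4 / c\<close> ensures \<open>|q + k| >= c * |q| >= 4\<close>,
    as \<open>boole_rem_bound\<close> requires.\<close>
  have main: "norm (q powr s * boole_tail N s q) \<le> ?B * (1 / norm q) ^ (2 * K + 3)"
    if q: "q \<in> sector \<delta>" and R: "norm q \<ge> max 1 (4 / c)" and s: "norm (s + of_nat n) \<le> 1" for q s
  proof -
    have slit: "q \<notin> \<real>\<^sub>\<le>\<^sub>0" by (rule sector_nonpos_Reals[OF assms(1) q])
    have q1: "norm q \<ge> 1" and q4: "c * norm q \<ge> 4" using R c(1) by (auto simp: field_simps)
    have sS: "norm s \<le> S"
      using norm_triangle_ineq4[of "s + of_nat n" "of_nat n"] s by (simp add: S_def)
    have re: "\<bar>Re s + real n\<bar> \<le> 1" using abs_Re_le_cmod[of "s + of_nat n"] s by simp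
    have 1: "norm (q powr s) \<le> exp (pi * S) * norm q"
    proof -
      have "norm (q powr s) \<le> exp (pi * norm s) * norm q powr Re s" by (rule norm_powr_le)
      also have "\<dots> \<le> exp (pi * S) * norm q powr 1"
        using sS re q1 by (intro mult_mono powr_mono) auto
      finally show ?thesis using q1 by simp
    qed
    have 2: "norm ((-1) ^ k * boole_rem N s (q + of_nat k))
               \<le> C * (1 / (c * norm q)) ^ (2 * K + 4) * (1 / (c * real (Suc k))) ^ 2" for k
    proof -
      let ?x = "q + of_nat k"
      have a: "c * norm q \<le> norm ?x"
        using c(2)[OF q, of k] c(1) by (smt (verit) mult_left_mono of_nat_0_le_iff)
      \<comment> \<open>From \<open>|q| >= 1\<close> follows \<open>|q| + k >= k + 1\<close>, so the
        majorant is also finite at \<open>k = 0\<close>.\<close>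
      have b: "c * real (Suc k) \<le> norm ?x"
      proof -
        have "c * real (Suc k) \<le> c * (norm q + real k)"
          using c(1) q1 by (intro mult_left_mono) auto
        thus ?thesis using c(2)[OF q, of k] by linarith
      qed
      have pos: "norm ?x > 0" "c * norm q > 0" "c * real (Suc k) > 0" using a q4 c(1) by auto
      have "norm ((-1) ^ k * boole_rem N s ?x) \<le> C * norm ?x powr (- Re s - real N)"
        using C(2)[OF sS _ nonpos_Reals_add_nat[OF slit], of k] a q4 by (simp add: norm_mult norm_power)
      also have "\<dots> \<le> C * norm ?x powr (- real (2 * K + 6))"
        using a q4 re C(1) by (intro mult_left_mono powr_mono) (auto simp: N_def)
      also have "norm ?x powr (- real (2 * K + 6)) = (1 / norm ?x) ^ (2 * K + 6)"
        using pos by (simp only: powr_minus powr_realpow power_one_over inverse_eq_divide)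
      also have "\<dots> = (1 / norm ?x) ^ (2 * K + 4) * (1 / norm ?x) ^ 2"
        by (simp add: power_add[symmetric] add.commute)
      also have "C * \<dots> \<le> C * ((1 / (c * norm q)) ^ (2 * K + 4) * (1 / (c * real (Suc k))) ^ 2)"
        using a b pos C(1)
        by (intro mult_left_mono mult_mono power_mono divide_left_mono) (auto simp del: of_nat_Suc)
      finally show ?thesis by (simp only: mult.assoc)
    qed
    have "norm (boole_tail N s q) \<le>
            (\<Sum>k. C * (1 / (c * norm q)) ^ (2 * K + 4) * (1 / (c * real (Suc k))) ^ 2)"
      unfolding boole_tail_def by (intro norm_suminf_le 2 summable_mult sT)
    also have "\<dots> = C * (1 / (c * norm q)) ^ (2 * K + 4) * T"
      unfolding T_def by (rule suminf_mult[OF sT])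
    finally have "norm (q powr s * boole_tail N s q) \<le>
        (exp (pi * S) * norm q) * (C * (1 / (c * norm q)) ^ (2 * K + 4) * T)"
      unfolding norm_mult by (intro mult_mono 1) auto
    also have "\<dots> = ?B * (norm q * (1 / norm q) ^ Suc (2 * K + 3))"
    proof -
      have "2 * K + 4 = Suc (2 * K + 3)" by simp
      thus ?thesis by (simp only: power_divide power_mult_distrib power_one) (simp del: power_Suc)
    qed
    also have "norm q * (1 / norm q) ^ Suc (2 * K + 3) = (1 / norm q) ^ (2 * K + 3)"
      using q1 by (subst power_Suc) auto
    finally show ?thesis .
  qed
  have "?B \<ge> 0" using C(1) T c(1) by simp
  moreover have "max 1 (4 / c) \<ge> 1" by simp
  ultimately show ?thesis using main by blast
qed

section \<open>Leibniz' rule and the final estimate\<close>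

lemma higher_deriv_powr_right:
  fixes q :: complex
  assumes "q \<noteq> 0"
  shows "(deriv ^^ i) (\<lambda>s. q powr s) = (\<lambda>s. Ln q ^ i * q powr s)"
proof (induction i)
  case (Suc i)
  have "((\<lambda>s. Ln q ^ i * q powr s) has_field_derivative (Ln q ^ i * (Ln q * q powr s))) (at s)" for s
    using assms unfolding powr_def by (auto intro!: derivative_eq_intros)
  hence "deriv (\<lambda>s. Ln q ^ i * q powr s) = (\<lambda>s. Ln q ^ i * (Ln q * q powr s))"
    by (intro ext DERIV_imp_deriv)
  thus ?case by (simp add: Suc.IH mult_ac)
qed simp

lemma higher_deriv_powr_mult_alt_hurwitz_zeta:
  assumes "q \<notin> \<real>\<^sub>\<le>\<^sub>0"
  shows "(deriv ^^ m) (\<lambda>s. q powr s * alt_hurwitz_zeta s q) s =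
    q powr s * (alt_hurwitz_zeta_deriv m s q +
      (\<Sum>j=1..m. of_nat (m choose j) * alt_hurwitz_zeta_deriv (m - j) s q * Ln q ^ j))"
proof -
  have q0: "q \<noteq> 0" using assms by auto
  have "(deriv ^^ m) (\<lambda>s. q powr s * alt_hurwitz_zeta s q) s =
      (\<Sum>j=0..m. of_nat (m choose j) * (deriv ^^ j) (\<lambda>s. q powr s) s * alt_hurwitz_zeta_deriv (m - j) s q)"
    unfolding alt_hurwitz_zeta_deriv_def
    by (rule higher_deriv_mult[of _ UNIV]) (auto intro!: holomorphic_intros alt_hurwitz_zeta assms)
  also have "\<dots> = q powr s * (\<Sum>j=0..m. of_nat (m choose j) * alt_hurwitz_zeta_deriv (m - j) s q * Ln q ^ j)"
    unfolding higher_deriv_powr_right[OF q0] sum_distrib_left by (intro sum.cong refl) (simp add: mult_ac)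
  also have "(\<Sum>j=0..m. of_nat (m choose j) * alt_hurwitz_zeta_deriv (m - j) s q * Ln q ^ j) =
      alt_hurwitz_zeta_deriv m s q + (\<Sum>j=1..m. of_nat (m choose j) * alt_hurwitz_zeta_deriv (m - j) s q * Ln q ^ j)"
    by (subst sum.atLeast_Suc_atMost) auto
  finally show ?thesis .
qed

theorem corollary3p15:
  fixes \<delta> :: real and n m K :: nat
  assumes "\<delta> > 0" and "m \<ge> 2"
  shows "(\<lambda>q :: complex. norm (alt_hurwitz_zeta_deriv m (- of_nat n) q -
            (- (\<Sum>j=1..m. of_nat (m choose j) *
                  alt_hurwitz_zeta_deriv (m - j) (- of_nat n) q * Ln q ^ j)
             - 1 / 2 * Sigma_trunc m n K q)))
         \<in> O[inf at_infinity (principal (sector \<delta>))](\<lambda>q. norm q powi (int n - 2 * int K - 3))"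
proof -
  \<comment> \<open>\<open>N\<close> makes the remainder series converge on the unit disc around
    \<open>-n\<close>, \<open>L\<close> is the order of the expansion, and \<open>S\<close> bounds
    \<open>|s|\<close> on that disc.\<close>
  define N where "N = n + 2 * K + 7"
  define L where "L = 2 * K + 3"
  define S where "S = real n + 1"
  obtain C R where C: "C \<ge> 0" "R \<ge> 1"
    "\<And>q s. q \<in> sector \<delta> \<Longrightarrow> norm q \<ge> R \<Longrightarrow> norm (s + of_nat n) \<le> 1 \<Longrightarrow>
       norm (q powr s * boole_tail N s q) \<le> C * (1 / norm q) ^ L"
    using boole_tail_bound[OF assms(1), of n K] unfolding N_def L_def by blast
  obtain D where D: "D \<ge> 0"
    "\<And>s u. norm s \<le> S \<Longrightarrow> norm u \<le> 1 \<Longrightarrow> norm (boole_main N s u - boole_main L s u) \<le> D * norm u ^ L"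
    using boole_main_diff_bound[of L N S] unfolding N_def L_def by auto
  have bound: "norm (alt_hurwitz_zeta_deriv m (- of_nat n) q -
            (- (\<Sum>j=1..m. of_nat (m choose j) *
                  alt_hurwitz_zeta_deriv (m - j) (- of_nat n) q * Ln q ^ j)
             - 1 / 2 * Sigma_trunc m n K q)) \<le> fact m * (C + D) * norm q powi (int n - 2 * int K - 3)"
    if q: "q \<in> sector \<delta>" and R: "norm q \<ge> R" for q
  proof -
    have slit: "q \<notin> \<real>\<^sub>\<le>\<^sub>0" by (rule sector_nonpos_Reals[OF assms(1) q])
    have q0: "q \<noteq> 0" using slit by auto
    have q1: "norm q \<ge> 1" using R C(2) by linarith
    define g where "g s = q powr s * alt_hurwitz_zeta s q" for s
    \<comment> \<open>The error before differentiation; it is estimated on the whole disc so that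
      Cauchy's inequality with radius \<open>1\<close> controls its derivatives at
      \<open>-n\<close>.\<close>
    define E where "E s = g s - boole_main L s (1 / q)" for s
    have g: "g holomorphic_on A" for A
      unfolding g_def[abs_def] using alt_hurwitz_zeta(1)[OF slit] holomorphic_on_subset
      by (intro holomorphic_intros) blast
    have E: "E holomorphic_on A" for A
      unfolding E_def[abs_def] by (intro holomorphic_intros g)
    have "norm (E s) \<le> (C + D) * (1 / norm q) ^ L" if s: "norm (s + of_nat n) \<le> 1" for s
    proof -
      have "Re s > 2 - real N"
        using abs_Re_le_cmod[of "s + of_nat n"] s by (simp add: N_def)
      hence "alt_hurwitz_zeta s q = boole_zeta N q s"
        by (intro alt_hurwitz_zeta(2) slit) (auto simp: N_def)
      hence "E s = (boole_main N s (1 / q) - boole_main L s (1 / q)) - q powr s * boole_tail N s q"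
        using q0 by (simp add: E_def g_def boole_zeta_def powr_minus field_simps)
      also have "norm \<dots> \<le> D * norm (1 / q) ^ L + C * (1 / norm q) ^ L"
      proof (rule order.trans[OF norm_triangle_ineq4 add_mono[OF D(2) C(3)[OF q R s]]])
        show "norm s \<le> S"
          using norm_triangle_ineq4[of "s + of_nat n" "of_nat n"] s by (simp add: S_def)
        show "norm (1 / q) \<le> 1" using q1 by (simp add: norm_divide divide_le_eq)
      qed
      finally show ?thesis by (simp add: norm_divide algebra_simps)
    qed
    hence "norm ((deriv ^^ m) E (- of_nat n)) \<le> fact m * ((C + D) * (1 / norm q) ^ L) / 1 ^ m"
      by (intro Cauchy_inequality holomorphic_on_imp_continuous_on E)
         (auto simp: norm_minus_commute add.commute)
    \<comment> \<open>The factor \<open>q^n\<close> undoes \<open>q powr s\<close> at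
      \<open>s = -n\<close> and turns \<open>|q|^(-L)\<close> into
      \<open>|q|^(n-2K-3)\<close>.\<close>
    hence "norm (q ^ n * (deriv ^^ m) E (- of_nat n)) \<le> norm q ^ n * (fact m * ((C + D) * (1 / norm q) ^ L))"
      unfolding norm_mult norm_power by (intro mult_left_mono) auto
    also have "\<dots> = fact m * (C + D) * (norm q ^ n * (1 / norm q) ^ L)"
      by (simp only: mult_ac)
    also have "norm q ^ n * (1 / norm q) ^ L = norm q powi (int n - 2 * int K - 3)"
    proof -
      have *: "int n - 2 * int K - 3 = int n - int L" by (simp add: L_def)
      show ?thesis unfolding * using q0 by (simp add: power_int_diff power_one_over inverse_eq_divide)
    qed
    also have "q ^ n * (deriv ^^ m) E (- of_nat n) = alt_hurwitz_zeta_deriv m (- of_nat n) q +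
         (\<Sum>j=1..m. of_nat (m choose j) * alt_hurwitz_zeta_deriv (m - j) (- of_nat n) q * Ln q ^ j)
           + 1 / 2 * Sigma_trunc m n K q"
    proof -
      have "(deriv ^^ m) E (- of_nat n) =
          (deriv ^^ m) g (- of_nat n) - (deriv ^^ m) (\<lambda>s. boole_main L s (1 / q)) (- of_nat n)"
        unfolding E_def[abs_def] by (rule higher_deriv_diff[of _ UNIV]) (auto intro!: holomorphic_intros g)
      moreover have "q ^ n * q powr (- of_nat n) = 1"
        using q0 by (simp add: powr_minus powr_nat')
      hence cancel: "q ^ n * (q powr (- of_nat n) * z) = z" for z
        by (simp flip: mult.assoc)
      moreover have "q ^ n * (\<Sum>k=1..K. (1 / q) ^ (2 * k + 1) * asymp_coeff m n k) = Sigma_trunc m n K q"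
        unfolding Sigma_trunc_def sum_distrib_left
      proof (intro sum.cong refl)
        fix k
        have "q powi (int n - int (2 * k + 1)) = q ^ n * (1 / q) ^ (2 * k + 1)"
          using q0 unfolding power_int_diff[OF disjI1[OF q0]] power_int_of_nat by (simp add: power_one_over)
        moreover have "int n - int (2 * k + 1) = int n - 2 * int k - 1" by simp
        ultimately have "q powi (int n - 2 * int k - 1) = q ^ n * (1 / q) ^ (2 * k + 1)" by metis
        thus "q ^ n * ((1 / q) ^ (2 * k + 1) * asymp_coeff m n k) =
            q powi (int n - 2 * int k - 1) * asymp_coeff m n k" by simp
      qed
      ultimately show ?thesis
        unfolding g_def[abs_def] higher_deriv_powr_mult_alt_hurwitz_zeta[OF slit]
          L_def higher_deriv_boole_main_eq[OF assms(2)]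
        by (simp add: right_diff_distrib distrib_left cancel)
    qed
    finally show ?thesis by (simp add: algebra_simps)
  qed
  show ?thesis
  proof (rule bigoI[where c = "fact m * (C + D)"])
    have "eventually (\<lambda>q :: complex. norm q \<ge> R) at_infinity"
      by (auto simp: eventually_at_infinity)
    hence "eventually (\<lambda>q. q \<in> sector \<delta> \<longrightarrow> norm q \<ge> R) at_infinity"
      by eventually_elim auto
    thus "\<forall>\<^sub>F q in inf at_infinity (principal (sector \<delta>)).
        norm (norm (alt_hurwitz_zeta_deriv m (- of_nat n) q -
            (- (\<Sum>j=1..m. of_nat (m choose j) *
                  alt_hurwitz_zeta_deriv (m - j) (- of_nat n) q * Ln q ^ j)
             - 1 / 2 * Sigma_trunc m n K q)))
        \<le> fact m * (C + D) * norm (norm q powi (int n - 2 * int K - 3))"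
      unfolding eventually_inf_principal
      by eventually_elim (use bound in simp)
  qed
qed

end
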